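(* Let $H_1,H_2,H_4,H_5$ be Hilbert spaces over the same field ($\mathbb{R}$ or $\mathbb{C}$), let $A_1\in\mathcal{L}_c(H_1,H_4)$, $A_2\in\mathcal{L}_c(H_1,H_5)$, $B_1\in\mathcal{L}_c(H_2,H_4)$, $B_2\in\mathcal{L}_c(H_2,H_5)$, and let $B=(B_1,B_2):H_2\to H_4\times H_5$. Assume that $\mathcal{N}(B^* )=\{0\}$, that the continuous extension of $B^*$ to the completed space $X$ (defined in the context) also has kernel $\{0\}$, and that there exists $C>0$ such that for any $h_4\in H_4$, $$\|A_1^*h_4\|_1\leqslant C\|B_1^*h_4\|_2.$$ Then for any $h_1\in H_1$ and any $\varepsilon>0$, there exists $h_2\in H_2$ such that $A_1h_1=B_1h_2$ and $\|A_2h_1-B_2h_2\|_5\leqslant\varepsilon$.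
   Context: $\mathcal{L}_c(E,F)$ denotes the set of continuous linear maps from $E$ to $F$, $\mathcal{N}(T)$ is the kernel of $T$, $T^*$ is the Hilbert space adjoint of $T$, and $\|\cdot\|_i$ is the norm of $H_i$. The product $H_4\times H_5$ carries the Hilbertian norm $\|(h_4,h_5)\|^2=\|h_4\|_4^2+\|h_5\|_5^2$, so that $B^*(h_4,h_5)=B_1^*h_4+B_2^*h_5$. Definition of $X$ (when $\mathcal{N}(B^* )=\{0\}$): $\|h_4\|_*:=\|B_1^*h_4\|_2$ is then a Hilbertian norm on $H_4$. Let $\overline{H_4}^{\|\cdot\|_*}$ be the completion of $H_4$ for this norm, and let $X=\overline{H_4}^{\|\cdot\|_*}\times H_5$, which is a Hilbert space for the norm given (on $H_4\times H_5$, and extended by continuity) by $\|(h_4,h_5)\|_*^2=\|B_1^*h_4\|_2^2+\|h_5\|_5^2$. The map $B^*:H_4\times H_5\to H_2$ extends uniquely to a continuous linear map $X\to H_2$, still denoted $B^*$. *)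

theory Defs
  imports "HOL-Analysis.Analysis"
begin

section \<open>Real and complex scalars\<close>

text \<open>
  A class whose only members are, up to isomorphism, the real and the complex numbers
  (lemma \<open>rc_field_real_or_complex\<close>), with \<open>rc_cnj\<close> being the identity and complex
  conjugation, respectively. It allows the two scalar fields to be treated at once.
\<close>

class rc_field = real_normed_field +
  fixes rc_cnj :: "'a \<Rightarrow> 'a"
  assumes rc_cnj_add: "rc_cnj (x + y) = rc_cnj x + rc_cnj y"
    and rc_cnj_mult: "rc_cnj (x * y) = rc_cnj x * rc_cnj y"
    and mult_rc_cnj_scaleR: "x * rc_cnj x = (norm x)\<^sup>2 *\<^sub>R 1"

instantiation real :: rc_field
begin
definition rc_cnj_real :: "real \<Rightarrow> real" where "rc_cnj_real x = x"
instance by standard (simp_all add: rc_cnj_real_def power2_eq_square)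
end

instantiation complex :: rc_field
begin
definition rc_cnj_complex :: "complex \<Rightarrow> complex" where "rc_cnj_complex = cnj"
instance
proof
  fix x :: complex
  show "x * rc_cnj x = (norm x)\<^sup>2 *\<^sub>R 1"
    unfolding rc_cnj_complex_def scaleR_conv_of_real by (simp only: complex_norm_square mult_1_right)
qed (simp_all add: rc_cnj_complex_def)
end

lemma mult_rc_cnj: "x * rc_cnj x = of_real ((norm x)\<^sup>2)"
  by (simp add: mult_rc_cnj_scaleR of_real_def)

lemma rc_cnj_of_real: "rc_cnj (of_real r :: 'k::rc_field) = of_real r"
proof (cases "r = 0")
  case True
  have "rc_cnj (0 + 0 :: 'k) = rc_cnj 0 + rc_cnj 0" by (rule rc_cnj_add)
  then show ?thesis using True by simp
next
  case False
  have "(of_real r :: 'k) * rc_cnj (of_real r) = of_real r * of_real r"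
    unfolding mult_rc_cnj by (simp add: power2_eq_square)
  then show ?thesis using False by simp
qed

lemma rc_field_real_or_complex:
  "(\<forall>x::'k::rc_field. \<exists>a. x = of_real a \<and> rc_cnj x = x) \<or>
   (\<exists>i::'k. i * i = -1 \<and> rc_cnj i = -i \<and> (\<forall>x. \<exists>a b. x = of_real a + of_real b * i))"
proof -
  have tr: "\<exists>t. x + rc_cnj x = of_real (2 * t)" for x :: 'k
  proof -
    have "(x + 1) * rc_cnj (x + 1) = x * rc_cnj x + (x + rc_cnj x) + 1"
      using rc_cnj_of_real[of 1, where 'k = 'k] by (simp add: rc_cnj_add algebra_simps)
    then have "x + rc_cnj x = of_real ((norm (x + 1))\<^sup>2 - (norm x)\<^sup>2 - 1)"
      unfolding mult_rc_cnj by (simp add: algebra_simps)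
    then show ?thesis by (intro exI[of _ "((norm (x + 1))\<^sup>2 - (norm x)\<^sup>2 - 1) / 2"]) simp
  qed
  have minus: "rc_cnj (- x) = - rc_cnj x" for x :: 'k
    using rc_cnj_mult[of "of_real (-1)" x] unfolding rc_cnj_of_real by simp
  show ?thesis
  proof (cases "\<forall>x::'k. \<exists>a. x = of_real a")
    case True
    then show ?thesis by (metis rc_cnj_of_real)
  next
    case False
    then obtain x :: 'k where x: "\<And>a. x \<noteq> of_real a" by blast
    obtain t where t: "x + rc_cnj x = of_real (2 * t)" using tr by blast
    define y where "y = x - of_real t"
    have y0: "y \<noteq> 0" using x y_def by auto
    have cy: "rc_cnj y = - y"
    proof -
      have "rc_cnj y = rc_cnj x - of_real t"
        using rc_cnj_add[of x "- of_real t"] unfolding minus rc_cnj_of_real by (simp add: y_def)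
      moreover have "rc_cnj x = of_real (2 * t) - x" using t by (metis add_diff_cancel_left')
      ultimately show ?thesis by (simp add: y_def)
    qed
    define i where "i = y / of_real (norm y)"
    have yi: "y = of_real (norm y) * i" using y0 by (simp add: i_def)
    have yy: "y * y = - of_real ((norm y)\<^sup>2)" using mult_rc_cnj[of y] cy by (metis minus_minus mult_minus_right)
    have ii: "i * i = -1"
      using y0 by (simp add: i_def yy power2_eq_square)
    have "i = of_real (inverse (norm y)) * y"
      by (simp add: i_def field_simps)
    then have ci: "rc_cnj i = - i" by (metis cy mult_minus_right rc_cnj_mult rc_cnj_of_real)
    have "\<exists>a b. z = of_real a + of_real b * i" for z
    proof -
      obtain p where p: "z + rc_cnj z = of_real (2 * p)" using tr by blast
      obtain q where q: "z * i + rc_cnj (z * i) = of_real (2 * q)" using tr by blast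
      have "z * i - rc_cnj z * i = of_real (2 * q)" using q ci by (simp add: rc_cnj_mult)
      then have "(z * i - rc_cnj z * i) * i = of_real (2 * q) * i" by simp
      moreover have "(z * i - rc_cnj z * i) * i = rc_cnj z - z"
        by (simp add: left_diff_distrib mult.assoc ii)
      ultimately have "rc_cnj z - z = of_real (2 * q) * i" by simp
      then have "2 * z = 2 * (of_real p + of_real (- q) * i)" using p by (simp add: algebra_simps)
      then show ?thesis by (metis mult_cancel_left zero_neq_numeral)
    qed
    then show ?thesis using ii ci by blast
  qed
qed


section \<open>Hilbert spaces, continuous linear maps, adjoints\<close>

text \<open>
  A Hilbert space over \<open>'k\<close> on a Banach space type: \<open>ip\<close> is linear in the first argument, and
  \<open>ip_self\<close> says both that \<open>ip\<close> is positive definite and that it induces the norm of the type.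
\<close>

locale hilbert_space = vector_space scale
  for scale :: "'k::rc_field \<Rightarrow> 'a::banach \<Rightarrow> 'a" +
  fixes ip :: "'a \<Rightarrow> 'a \<Rightarrow> 'k"
  assumes scale_of_real: "scale (of_real r) x = r *\<^sub>R x"
    and ip_add_left: "ip (x + y) z = ip x z + ip y z"
    and ip_scale_left: "ip (scale c x) y = c * ip x y"
    and ip_commute: "ip y x = rc_cnj (ip x y)"
    and ip_self: "ip x x = of_real ((norm x)\<^sup>2)"

lemma hilbert_space_real:
  "hilbert_space scaleR (inner :: 'a::{real_inner, banach} \<Rightarrow> 'a \<Rightarrow> real)"
proof unfold_locales
  fix x y :: 'a
  show "inner y x = rc_cnj (inner x y)" by (simp add: rc_cnj_real_def inner_commute)
  show "inner x x = of_real ((norm x)\<^sup>2)" by (simp add: power2_norm_eq_inner)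
qed (simp_all add: scaleR_right_distrib scaleR_left_distrib inner_add_left)

lemma hilbert_space_complex:
  "hilbert_space (*) (\<lambda>x y :: complex. x * cnj y)"
proof unfold_locales
  fix x y :: complex
  show "y * cnj x = rc_cnj (x * cnj y)" by (simp add: rc_cnj_complex_def)
  show "x * cnj x = of_real ((norm x)\<^sup>2)" by (simp only: complex_norm_square)
qed (simp_all add: distrib_left distrib_right scaleR_conv_of_real)

definition continuous_linear ::
    "('k::field \<Rightarrow> 'a::real_normed_vector \<Rightarrow> 'a) \<Rightarrow> ('k \<Rightarrow> 'b::real_normed_vector \<Rightarrow> 'b)
      \<Rightarrow> ('a \<Rightarrow> 'b) \<Rightarrow> bool"
  where "continuous_linear s1 s2 T \<longleftrightarrow> Vector_Spaces.linear s1 s2 T \<and> continuous_on UNIV T"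

definition hilbert_adjoint ::
    "('a \<Rightarrow> 'a \<Rightarrow> 'k) \<Rightarrow> ('b \<Rightarrow> 'b \<Rightarrow> 'k) \<Rightarrow> ('a \<Rightarrow> 'b) \<Rightarrow> 'b \<Rightarrow> 'a"
  where "hilbert_adjoint ip1 ip2 T = (THE S. \<forall>x y. ip2 (T x) y = ip1 x (S y))"

text \<open>The norm induced by this inner product is the norm of the product type.\<close>

definition prod_ip ::
    "('a \<Rightarrow> 'a \<Rightarrow> 'k::plus) \<Rightarrow> ('b \<Rightarrow> 'b \<Rightarrow> 'k) \<Rightarrow> 'a \<times> 'b \<Rightarrow> 'a \<times> 'b \<Rightarrow> 'k"
  where "prod_ip ip1 ip2 z w = ip1 (fst z) (fst w) + ip2 (snd z) (snd w)"


definition pair_adjoint ::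
    "('c \<Rightarrow> 'c \<Rightarrow> 'k::plus) \<Rightarrow> ('a \<Rightarrow> 'a \<Rightarrow> 'k) \<Rightarrow> ('b \<Rightarrow> 'b \<Rightarrow> 'k)
      \<Rightarrow> ('c \<Rightarrow> 'a) \<Rightarrow> ('c \<Rightarrow> 'b) \<Rightarrow> 'a \<times> 'b \<Rightarrow> 'c"
  where "pair_adjoint ip ip1 ip2 B1 B2 = hilbert_adjoint ip (prod_ip ip1 ip2) (\<lambda>h. (B1 h, B2 h))"

definition norm_star ::
    "('c::real_normed_vector \<Rightarrow> 'c \<Rightarrow> 'k) \<Rightarrow> ('a \<Rightarrow> 'a \<Rightarrow> 'k) \<Rightarrow> ('c \<Rightarrow> 'a) \<Rightarrow> 'a \<Rightarrow> real"
  where "norm_star ip ip1 B1 h = norm (hilbert_adjoint ip ip1 B1 h)"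


section \<open>Completion for a norm other than that of the type\<close>

text \<open>
  The completion of \<open>'a\<close> for the norm \<open>N\<close>, as the set of classes of \<open>N\<close>-Cauchy sequences modulo
  sequences tending to \<open>0\<close>. The locale constants of \<open>Metric_space\<close> used here have their meaning
  only when \<open>N\<close> is a norm (locale \<open>group_norm\<close> below).
\<close>

definition cauchy_seqs :: "('a::ab_group_add \<Rightarrow> real) \<Rightarrow> (nat \<Rightarrow> 'a) set"
  where "cauchy_seqs N = {x. Metric_space.MCauchy UNIV (\<lambda>u v. N (u - v)) x}"

definition completion_rel :: "('a::ab_group_add \<Rightarrow> real) \<Rightarrow> ((nat \<Rightarrow> 'a) \<times> (nat \<Rightarrow> 'a)) set"
  where "completion_rel N =
    {(x, y). x \<in> cauchy_seqs N \<and> y \<in> cauchy_seqs N \<and> (\<lambda>n. N (x n - y n)) \<longlonglongrightarrow> 0}"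

definition norm_completion :: "('a::ab_group_add \<Rightarrow> real) \<Rightarrow> (nat \<Rightarrow> 'a) set set"
  where "norm_completion N = cauchy_seqs N // completion_rel N"

definition completion_embed :: "('a::ab_group_add \<Rightarrow> real) \<Rightarrow> 'a \<Rightarrow> (nat \<Rightarrow> 'a) set"
  where "completion_embed N h = completion_rel N `` {\<lambda>_. h}"

definition completion_add ::
    "('a::ab_group_add \<Rightarrow> real) \<Rightarrow> (nat \<Rightarrow> 'a) set \<Rightarrow> (nat \<Rightarrow> 'a) set \<Rightarrow> (nat \<Rightarrow> 'a) set"
  where "completion_add N P Q = (\<Union>x\<in>P. \<Union>y\<in>Q. completion_rel N `` {\<lambda>n. x n + y n})"

definition completion_scale ::
    "('k \<Rightarrow> 'a \<Rightarrow> 'a) \<Rightarrow> ('a::ab_group_add \<Rightarrow> real) \<Rightarrow> 'k \<Rightarrow> (nat \<Rightarrow> 'a) set \<Rightarrow> (nat \<Rightarrow> 'a) set"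
  where "completion_scale s N c P = (\<Union>x\<in>P. completion_rel N `` {\<lambda>n. s c (x n)})"

text \<open>The value \<open>0\<close> off the completion is there because \<open>Metric_space\<close> wants a total distance.\<close>

definition completion_dist ::
    "('a::ab_group_add \<Rightarrow> real) \<Rightarrow> (nat \<Rightarrow> 'a) set \<Rightarrow> (nat \<Rightarrow> 'a) set \<Rightarrow> real"
  where "completion_dist N P Q =
    (if P \<in> norm_completion N \<and> Q \<in> norm_completion N
     then THE l. \<forall>x\<in>P. \<forall>y\<in>Q. (\<lambda>n. N (x n - y n)) \<longlonglongrightarrow> l else 0)"

definition completed_prod :: "('a::ab_group_add \<Rightarrow> real) \<Rightarrow> ((nat \<Rightarrow> 'a) set \<times> 'b) set"
  where "completed_prod N = norm_completion N \<times> UNIV"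

definition completed_prod_zero ::
    "('a::ab_group_add \<Rightarrow> real) \<Rightarrow> (nat \<Rightarrow> 'a) set \<times> 'b::zero"
  where "completed_prod_zero N = (completion_embed N 0, 0)"

definition completed_prod_topology ::
    "('a::ab_group_add \<Rightarrow> real) \<Rightarrow> ((nat \<Rightarrow> 'a) set \<times> 'b::real_normed_vector) topology"
  where "completed_prod_topology N =
    Metric_space.mtopology (completed_prod N) (prod_dist (completion_dist N) dist)"

definition is_extension ::
    "('k \<Rightarrow> 'a \<Rightarrow> 'a) \<Rightarrow> ('k \<Rightarrow> 'b \<Rightarrow> 'b) \<Rightarrow> ('k \<Rightarrow> 'c \<Rightarrow> 'c) \<Rightarrow> ('a::ab_group_add \<Rightarrow> real)
      \<Rightarrow> ('a \<times> 'b::real_normed_vector \<Rightarrow> 'c::real_normed_vector)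
      \<Rightarrow> ((nat \<Rightarrow> 'a) set \<times> 'b \<Rightarrow> 'c) \<Rightarrow> bool"
  where "is_extension sa sb sc N T F \<longleftrightarrow>
    F \<in> extensional (completed_prod N) \<and>
    continuous_map (completed_prod_topology N) euclidean F \<and>
    (\<forall>P\<in>norm_completion N. \<forall>Q\<in>norm_completion N. \<forall>a b.
      F (completion_add N P Q, a + b) = F (P, a) + F (Q, b)) \<and>
    (\<forall>c. \<forall>P\<in>norm_completion N. \<forall>a. F (completion_scale sa N c P, sb c a) = sc c (F (P, a))) \<and>
    (\<forall>h a. F (completion_embed N h, a) = T (h, a))"

text \<open>
  The continuous linear extension of \<open>T\<close>; lemma \<open>is_extension_ex1\<close> below shows that it exists
  and is unique when \<open>T\<close> is linear and bounded for the norm on \<open>'a \<times> 'b\<close> given by \<open>N\<close>.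
\<close>

definition completed_extension ::
    "('k \<Rightarrow> 'a \<Rightarrow> 'a) \<Rightarrow> ('k \<Rightarrow> 'b \<Rightarrow> 'b) \<Rightarrow> ('k \<Rightarrow> 'c \<Rightarrow> 'c) \<Rightarrow> ('a::ab_group_add \<Rightarrow> real)
      \<Rightarrow> ('a \<times> 'b::real_normed_vector \<Rightarrow> 'c::real_normed_vector)
      \<Rightarrow> (nat \<Rightarrow> 'a) set \<times> 'b \<Rightarrow> 'c"
  where "completed_extension sa sb sc N T = (THE F. is_extension sa sb sc N T F)"

locale group_norm =
  fixes N :: "'a::ab_group_add \<Rightarrow> real"
  assumes N_eq_0: "N x = 0 \<longleftrightarrow> x = 0" and N_minus: "N (- x) = N x"
    and N_add: "N (x + y) \<le> N x + N y"
begin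

lemma N_nonneg: "0 \<le> N x"
  using N_add[of x "- x"] N_minus[of x] N_eq_0[of 0] by simp

lemma N_diff_commute: "N (x - y) = N (y - x)"
  using N_minus[of "x - y"] by simp

lemma N_triangle: "N (x - z) \<le> N (x - y) + N (y - z)"
  using N_add[of "x - y" "y - z"] by simp

sublocale norm_metric: Metric_space UNIV "\<lambda>u v. N (u - v)"
  by unfold_locales (simp_all add: N_nonneg N_diff_commute N_triangle N_eq_0)

lemma cauchy_seqs_iff:
  "x \<in> cauchy_seqs N \<longleftrightarrow> (\<forall>e>0. \<exists>k. \<forall>m n. k \<le> m \<longrightarrow> k \<le> n \<longrightarrow> N (x m - x n) < e)"
  by (simp add: cauchy_seqs_def norm_metric.MCauchy_def)

lemma const_cauchy: "(\<lambda>_. h) \<in> cauchy_seqs N"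
  using N_eq_0[of 0] by (auto simp: cauchy_seqs_iff)

lemma diff4: "\<bar>N (a - b) - N (c - d)\<bar> \<le> N (a - c) + N (b - d)"
  using N_triangle[of a b c] N_triangle[of c b d] N_triangle[of c d a] N_triangle[of a d b]
    N_diff_commute[of a c] N_diff_commute[of b d] by linarith

lemma cauchy_diff_convergent:
  assumes "x \<in> cauchy_seqs N" "y \<in> cauchy_seqs N"
  shows "convergent (\<lambda>n. N (x n - y n))"
proof -
  have "Cauchy (\<lambda>n. N (x n - y n))"
  proof (rule metric_CauchyI)
    fix e :: real assume "e > 0"
    then have e2: "e / 2 > 0" by simp
    obtain k where k: "\<And>m n. k \<le> m \<Longrightarrow> k \<le> n \<Longrightarrow> N (x m - x n) < e / 2"
      using assms(1) e2 unfolding cauchy_seqs_iff by blast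
    obtain l where l: "\<And>m n. l \<le> m \<Longrightarrow> l \<le> n \<Longrightarrow> N (y m - y n) < e / 2"
      using assms(2) e2 unfolding cauchy_seqs_iff by blast
    have "dist (N (x m - y m)) (N (x n - y n)) < e" if "m \<ge> max k l" "n \<ge> max k l" for m n
      using diff4[of "x m" "y m" "x n" "y n"] k[of m n] l[of m n] that by (simp add: dist_real_def)
    then show "\<exists>M. \<forall>m\<ge>M. \<forall>n\<ge>M. dist (N (x m - y m)) (N (x n - y n)) < e" by blast
  qed
  then show ?thesis by (simp add: Cauchy_convergent)
qed

lemma null_trans:
  assumes "(\<lambda>n. N (x n - y n)) \<longlonglongrightarrow> 0" "(\<lambda>n. N (y n - z n)) \<longlonglongrightarrow> 0"
  shows "(\<lambda>n. N (x n - z n)) \<longlonglongrightarrow> 0"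
proof (rule tendsto_sandwich[of "\<lambda>_. 0"])
  show "(\<lambda>n. N (x n - y n) + N (y n - z n)) \<longlonglongrightarrow> 0"
    using tendsto_add[OF assms] by simp
  show "\<forall>\<^sub>F n in sequentially. N (x n - z n) \<le> N (x n - y n) + N (y n - z n)"
    by (intro always_eventually allI N_triangle)
qed (simp_all add: N_nonneg)

lemma equiv_completion_rel: "equiv (cauchy_seqs N) (completion_rel N)"
proof (rule equivI)
  show "refl_on (cauchy_seqs N) (completion_rel N)"
    using N_eq_0[of 0] by (simp add: refl_on_def completion_rel_def)
  show "sym (completion_rel N)"
    by (rule symI) (simp add: completion_rel_def N_diff_commute)
  show "trans (completion_rel N)"
  proof (rule transI)
    fix x y z assume "(x, y) \<in> completion_rel N" "(y, z) \<in> completion_rel N"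
    then show "(x, z) \<in> completion_rel N"
      using null_trans[of x y z] by (simp add: completion_rel_def)
  qed
qed (auto simp: completion_rel_def)

abbreviation cls :: "(nat \<Rightarrow> 'a) \<Rightarrow> (nat \<Rightarrow> 'a) set"
  where "cls x \<equiv> completion_rel N `` {x}"

lemma cls_in: "x \<in> cauchy_seqs N \<Longrightarrow> cls x \<in> norm_completion N"
  by (simp add: norm_completion_def quotientI)

lemma self_in_cls: "x \<in> cauchy_seqs N \<Longrightarrow> x \<in> cls x"
  by (rule equiv_class_self[OF equiv_completion_rel])

lemma completionE:
  assumes "P \<in> norm_completion N"
  obtains x where "x \<in> cauchy_seqs N" "P = cls x"
  using assms unfolding norm_completion_def by (rule quotientE)

lemma completion_pairE:
  assumes "z \<in> completed_prod N"
  obtains x a where "x \<in> cauchy_seqs N" "z = (cls x, a)"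
proof -
  obtain P a where z: "z = (P, a)" "P \<in> norm_completion N"
    using assms by (cases z) (auto simp: completed_prod_def)
  then show ?thesis using completionE[of P] that by blast
qed

lemma in_cls_iff:
  "y \<in> cls x \<longleftrightarrow> x \<in> cauchy_seqs N \<and> y \<in> cauchy_seqs N \<and> (\<lambda>n. N (x n - y n)) \<longlonglongrightarrow> 0"
  by (auto simp: completion_rel_def)

lemma cls_eq_iff:
  assumes "x \<in> cauchy_seqs N" "y \<in> cauchy_seqs N"
  shows "cls x = cls y \<longleftrightarrow> (\<lambda>n. N (x n - y n)) \<longlonglongrightarrow> 0"
  using eq_equiv_class_iff[OF equiv_completion_rel assms] assms by (auto simp: completion_rel_def)

lemma completion_dist_eqI:
  assumes x: "x \<in> cauchy_seqs N" and y: "y \<in> cauchy_seqs N"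
    and l: "(\<lambda>n. N (x n - y n)) \<longlonglongrightarrow> l"
  shows "completion_dist N (cls x) (cls y) = l"
proof -
  have "(THE l. \<forall>x'\<in>cls x. \<forall>y'\<in>cls y. (\<lambda>n. N (x' n - y' n)) \<longlonglongrightarrow> l) = l"
  proof (rule the_equality)
    show "\<forall>x'\<in>cls x. \<forall>y'\<in>cls y. (\<lambda>n. N (x' n - y' n)) \<longlonglongrightarrow> l"
    proof (intro ballI)
      fix x' y' assume x': "x' \<in> cls x" and y': "y' \<in> cls y"
      have "(\<lambda>n. N (x n - x' n) + N (y n - y' n)) \<longlonglongrightarrow> 0 + 0"
        using x' y' unfolding in_cls_iff by (intro tendsto_add) auto
      then have s: "(\<lambda>n. N (x n - x' n) + N (y n - y' n)) \<longlonglongrightarrow> 0" by simp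
      have "(\<lambda>n. N (x n - y n) - N (x' n - y' n)) \<longlonglongrightarrow> 0"
        by (rule Lim_null_comparison[OF _ s]) (simp add: diff4)
      from tendsto_diff[OF l this] show "(\<lambda>n. N (x' n - y' n)) \<longlonglongrightarrow> l" by simp
    qed
    fix l' assume "\<forall>x'\<in>cls x. \<forall>y'\<in>cls y. (\<lambda>n. N (x' n - y' n)) \<longlonglongrightarrow> l'"
    then have "(\<lambda>n. N (x n - y n)) \<longlonglongrightarrow> l'" using self_in_cls x y by blast
    then show "l' = l" using l LIMSEQ_unique by blast
  qed
  then show ?thesis using x y by (simp add: completion_dist_def cls_in)
qed

lemma completion_dist_tendsto:
  assumes "x \<in> cauchy_seqs N" "y \<in> cauchy_seqs N"
  shows "(\<lambda>n. N (x n - y n)) \<longlonglongrightarrow> completion_dist N (cls x) (cls y)"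
proof -
  obtain l where l: "(\<lambda>n. N (x n - y n)) \<longlonglongrightarrow> l"
    using cauchy_diff_convergent[OF assms] unfolding convergent_def by blast
  then show ?thesis by (simp only: completion_dist_eqI[OF assms l])
qed

lemma Metric_space_completion: "Metric_space (norm_completion N) (completion_dist N)"
proof
  fix P Q :: "(nat \<Rightarrow> 'a) set"
  show "0 \<le> completion_dist N P Q"
  proof (cases "P \<in> norm_completion N \<and> Q \<in> norm_completion N")
    case True
    obtain x where x: "x \<in> cauchy_seqs N" "P = cls x" using True completionE[of P] by blast
    obtain y where y: "y \<in> cauchy_seqs N" "Q = cls y" using True completionE[of Q] by blast
    show ?thesis
      unfolding x(2) y(2)
      using LIMSEQ_le_const[OF completion_dist_tendsto[OF x(1) y(1)]] N_nonneg by blast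
  next
    case False
    then show ?thesis by (auto simp: completion_dist_def)
  qed
  show "completion_dist N P Q = completion_dist N Q P"
  proof (cases "P \<in> norm_completion N \<and> Q \<in> norm_completion N")
    case True
    obtain x where x: "x \<in> cauchy_seqs N" "P = cls x" using True completionE[of P] by blast
    obtain y where y: "y \<in> cauchy_seqs N" "Q = cls y" using True completionE[of Q] by blast
    have "(\<lambda>n. N (y n - x n)) \<longlonglongrightarrow> completion_dist N (cls x) (cls y)"
      using completion_dist_tendsto[OF x(1) y(1)] by (subst N_diff_commute)
    from completion_dist_eqI[OF y(1) x(1) this] show ?thesis by (simp only: x(2) y(2))
  next
    case False
    then show ?thesis by (auto simp: completion_dist_def)
  qed
next
  fix P Q assume PQ: "P \<in> norm_completion N" "Q \<in> norm_completion N"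
  obtain x where x: "x \<in> cauchy_seqs N" "P = cls x" using PQ completionE[of P] by blast
  obtain y where y: "y \<in> cauchy_seqs N" "Q = cls y" using PQ completionE[of Q] by blast
  show "completion_dist N P Q = 0 \<longleftrightarrow> P = Q"
    unfolding x(2) y(2) cls_eq_iff[OF x(1) y(1)]
    using completion_dist_tendsto[OF x(1) y(1)] completion_dist_eqI[OF x(1) y(1), of 0] by metis
next
  fix P Q R assume PQ: "P \<in> norm_completion N" "Q \<in> norm_completion N" "R \<in> norm_completion N"
  obtain x where x: "x \<in> cauchy_seqs N" "P = cls x" using PQ completionE[of P] by blast
  obtain y where y: "y \<in> cauchy_seqs N" "Q = cls y" using PQ completionE[of Q] by blast
  obtain z where z: "z \<in> cauchy_seqs N" "R = cls z" using PQ completionE[of R] by blast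
  have "(\<lambda>n. N (x n - y n) + N (y n - z n)) \<longlonglongrightarrow> completion_dist N P Q + completion_dist N Q R"
    unfolding x(2) y(2) z(2) using x(1) y(1) z(1) by (intro tendsto_add completion_dist_tendsto)
  note add = this
  have "(\<lambda>n. N (x n - z n)) \<longlonglongrightarrow> completion_dist N P R"
    unfolding x(2) z(2) using x(1) z(1) by (intro completion_dist_tendsto)
  from LIMSEQ_le[OF this add] N_triangle
  show "completion_dist N P R \<le> completion_dist N P Q + completion_dist N Q R"
    by blast
qed

lemma Metric_space_completed_prod:
  "Metric_space (completed_prod N :: ((nat \<Rightarrow> 'a) set \<times> 'b::real_normed_vector) set)
    (prod_dist (completion_dist N) dist)"
proof -
  interpret Metric_space12 "norm_completion N" "completion_dist N" "UNIV :: 'b set" dist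
    using Metric_space_completion Met_TC.Metric_space_axioms by (simp add: Metric_space12_def)
  show ?thesis unfolding completed_prod_def by (rule prod_metric)
qed

lemma cls_const: "completion_embed N h = cls (\<lambda>_. h)"
  by (simp add: completion_embed_def)

lemma embed_in: "completion_embed N h \<in> norm_completion N"
  by (simp add: cls_const cls_in const_cauchy)

lemma completion_dist_embed: "completion_dist N (completion_embed N g) (completion_embed N h) = N (g - h)"
  unfolding cls_const by (rule completion_dist_eqI) (simp_all add: const_cauchy)

lemma cauchy_add:
  assumes "x \<in> cauchy_seqs N" "y \<in> cauchy_seqs N"
  shows "(\<lambda>n. x n + y n) \<in> cauchy_seqs N"
  unfolding cauchy_seqs_iff
proof (intro allI impI)
  fix e :: real assume "e > 0"
  then have e2: "e / 2 > 0" by simp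
  obtain k where k: "\<And>m n. k \<le> m \<Longrightarrow> k \<le> n \<Longrightarrow> N (x m - x n) < e / 2"
    using assms(1) e2 unfolding cauchy_seqs_iff by blast
  obtain l where l: "\<And>m n. l \<le> m \<Longrightarrow> l \<le> n \<Longrightarrow> N (y m - y n) < e / 2"
    using assms(2) e2 unfolding cauchy_seqs_iff by blast
  have "N ((x m + y m) - (x n + y n)) < e" if "m \<ge> max k l" "n \<ge> max k l" for m n
    using N_add[of "x m - x n" "y m - y n"] k[of m n] l[of m n] that by (simp add: algebra_simps)
  then show "\<exists>k. \<forall>m n. k \<le> m \<longrightarrow> k \<le> n \<longrightarrow> N (x m + y m - (x n + y n)) < e" by blast
qed

lemma completion_add_cls:
  assumes x: "x \<in> cauchy_seqs N" and y: "y \<in> cauchy_seqs N"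
  shows "completion_add N (cls x) (cls y) = cls (\<lambda>n. x n + y n)"
proof -
  have "cls (\<lambda>n. x' n + y' n) = cls (\<lambda>n. x n + y n)" if x': "x' \<in> cls x" and y': "y' \<in> cls y" for x' y'
  proof -
    have c: "x' \<in> cauchy_seqs N" "y' \<in> cauchy_seqs N" using x' y' in_cls_iff by auto
    have "(\<lambda>n. N (x n - x' n) + N (y n - y' n)) \<longlonglongrightarrow> 0 + 0"
      using x' y' unfolding in_cls_iff by (intro tendsto_add) auto
    then have s: "(\<lambda>n. N (x n - x' n) + N (y n - y' n)) \<longlonglongrightarrow> 0" by simp
    have le: "N (x n + y n - (x' n + y' n)) \<le> N (x n - x' n) + N (y n - y' n)" for n
      using N_add[of "x n - x' n" "y n - y' n"] by (simp add: algebra_simps)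
    have "(\<lambda>n. N (x n + y n - (x' n + y' n))) \<longlonglongrightarrow> 0"
      by (rule Lim_null_comparison[OF _ s]) (simp add: le N_nonneg)
    then have "cls (\<lambda>n. x n + y n) = cls (\<lambda>n. x' n + y' n)"
      by (subst cls_eq_iff) (simp_all add: cauchy_add x y c)
    then show ?thesis by simp
  qed
  then have "(\<Union>y'\<in>cls y. cls (\<lambda>n. x' n + y' n)) = cls (\<lambda>n. x n + y n)" if "x' \<in> cls x" for x'
    using that self_in_cls[OF y] by blast
  then show ?thesis
    unfolding completion_add_def using self_in_cls[OF x] by blast
qed

lemma embed_seq_tendsto:
  assumes x: "x \<in> cauchy_seqs N"
  shows "(\<lambda>n. completion_dist N (completion_embed N (x n)) (cls x)) \<longlonglongrightarrow> 0"
proof (rule LIMSEQ_I)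
  fix e :: real assume "e > 0"
  then have e2: "e / 2 > 0" by simp
  obtain k where k: "\<And>m n. k \<le> m \<Longrightarrow> k \<le> n \<Longrightarrow> N (x m - x n) < e / 2"
    using x e2 unfolding cauchy_seqs_iff by blast
  interpret C: Metric_space "norm_completion N" "completion_dist N" by (rule Metric_space_completion)
  have "completion_dist N (completion_embed N (x m)) (cls x) \<le> e / 2" if m: "m \<ge> k" for m
  proof (rule LIMSEQ_le_const2)
    show "(\<lambda>n. N (x m - x n)) \<longlonglongrightarrow> completion_dist N (completion_embed N (x m)) (cls x)"
      unfolding cls_const using completion_dist_tendsto[OF const_cauchy x] .
    show "\<exists>M. \<forall>n\<ge>M. N (x m - x n) \<le> e / 2" using k m less_imp_le by meson
  qed
  then show "\<exists>no. \<forall>n\<ge>no. norm (completion_dist N (completion_embed N (x n)) (cls x) - 0) < e"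
    using \<open>e > 0\<close> by (intro exI[of _ k]) (force simp: C.nonneg)
qed

lemma mcomplete_completion: "Metric_space.mcomplete (norm_completion N) (completion_dist N)"
proof -
  interpret C: Metric_space "norm_completion N" "completion_dist N" by (rule Metric_space_completion)
  show ?thesis
    unfolding C.mcomplete_def
  proof (intro allI impI)
    fix P assume P: "C.MCauchy P"
    then have Pin: "P n \<in> norm_completion N" for n by (auto simp: C.MCauchy_def)
    have "\<exists>h. completion_dist N (completion_embed N h) (P n) < inverse (real (Suc n))" for n
    proof -
      obtain x where x: "x \<in> cauchy_seqs N" "P n = cls x" using Pin[of n] by (rule completionE)
      have "\<forall>\<^sub>F m in sequentially.
          completion_dist N (completion_embed N (x m)) (cls x) < inverse (real (Suc n))"
        using embed_seq_tendsto[OF x(1)] by (rule order_tendstoD) simp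
      from eventually_happens'[OF sequentially_bot this] show ?thesis unfolding x(2) by blast
    qed
    then obtain h where
      h: "\<And>n. completion_dist N (completion_embed N (h n)) (P n) < inverse (real (Suc n))" by metis
    have hc: "h \<in> cauchy_seqs N"
      unfolding cauchy_seqs_iff
    proof (intro allI impI)
      fix e :: real assume "e > 0"
      then have e3: "e / 3 > 0" by simp
      obtain k where k: "\<And>m n. k \<le> m \<Longrightarrow> k \<le> n \<Longrightarrow> completion_dist N (P m) (P n) < e / 3"
        using P e3 unfolding C.MCauchy_def by blast
      obtain l where l: "inverse (real (Suc l)) < e / 3" using e3 reals_Archimedean by blast
      have "N (h m - h n) < e" if mn: "m \<ge> max k l" "n \<ge> max k l" for m n
      proof -
        have "inverse (real (Suc m)) \<le> inverse (real (Suc l))"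
          "inverse (real (Suc n)) \<le> inverse (real (Suc l))"
          using mn by (auto intro!: le_imp_inverse_le)
        moreover have "completion_dist N (completion_embed N (h m)) (completion_embed N (h n))
          \<le> completion_dist N (completion_embed N (h m)) (P m) + completion_dist N (P m) (P n)
            + completion_dist N (P n) (completion_embed N (h n))"
          using C.triangle[OF embed_in[of "h m"] Pin[of m] embed_in[of "h n"]]
            C.triangle[OF Pin[of m] Pin[of n] embed_in[of "h n"]] by linarith
        ultimately show ?thesis
          using h[of m] h[of n] k[of m n] l mn
            C.commute[of "P n" "completion_embed N (h n)"]
          unfolding completion_dist_embed by linarith
      qed
      then show "\<exists>k. \<forall>m n. k \<le> m \<longrightarrow> k \<le> n \<longrightarrow> N (h m - h n) < e" by blast
    qed
    have lim: "(\<lambda>n. inverse (real (Suc n)) + completion_dist N (completion_embed N (h n)) (cls h)) \<longlonglongrightarrow> 0"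
      using tendsto_add[OF LIMSEQ_inverse_real_of_nat embed_seq_tendsto[OF hc]] by simp
    have "completion_dist N (P n) (cls h)
        \<le> inverse (real (Suc n)) + completion_dist N (completion_embed N (h n)) (cls h)" for n
      using C.triangle[OF Pin[of n] embed_in[of "h n"] cls_in[OF hc]] h[of n]
        C.commute[of "P n" "completion_embed N (h n)"] by linarith
    then have "(\<lambda>n. completion_dist N (P n) (cls h)) \<longlonglongrightarrow> 0"
      by (intro Lim_null_comparison[OF _ lim]) (simp add: C.nonneg)
    then show "\<exists>Q. limitin C.mtopology P Q sequentially"
      using Pin cls_in[OF hc] by (auto simp: C.limitin_metric_dist_null)
  qed
qed

lemma limitin_embed_seq:
  fixes a :: "'b::real_normed_vector"
  assumes x: "x \<in> cauchy_seqs N"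
  shows "limitin (completed_prod_topology N) (\<lambda>n. (completion_embed N (x n), a)) (cls x, a) sequentially"
proof -
  interpret X: Metric_space "completed_prod N :: ((nat \<Rightarrow> 'a) set \<times> 'b) set"
    "prod_dist (completion_dist N) dist" by (rule Metric_space_completed_prod)
  show ?thesis
    unfolding completed_prod_topology_def X.limitin_metric_dist_null
    using embed_seq_tendsto[OF x] x
    by (auto simp: completed_prod_def cls_in embed_in prod_dist_def tendsto_rabs_zero)
qed

lemma extension_unique:
  fixes F G :: "(nat \<Rightarrow> 'a) set \<times> 'b::real_normed_vector \<Rightarrow> 'c::real_normed_vector"
  assumes F: "is_extension sa sb sc N T F" and G: "is_extension sa sb sc N T G"
  shows "F = G"
proof (rule extensionalityI)
  show "F \<in> extensional (completed_prod N)" "G \<in> extensional (completed_prod N)"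
    using F G by (simp_all add: is_extension_def)
  fix z :: "(nat \<Rightarrow> 'a) set \<times> 'b" assume "z \<in> completed_prod N"
  then obtain x a where x: "x \<in> cauchy_seqs N" and z: "z = (cls x, a)"
    by (rule completion_pairE)
  have "(\<lambda>n. T (x n, a)) \<longlonglongrightarrow> H z" if H: "is_extension sa sb sc N T H" for H
    using continuous_map_limit[OF _ limitin_embed_seq[OF x, of a], of euclidean H] H
    by (simp add: is_extension_def z o_def)
  then show "F z = G z" using F G LIMSEQ_unique by blast
qed

lemma is_extension_ex1:
  fixes T :: "'a \<times> 'b::real_normed_vector \<Rightarrow> 'c::banach"
    and sa :: "'k::real_normed_field \<Rightarrow> 'a \<Rightarrow> 'a" and sb :: "'k \<Rightarrow> 'b \<Rightarrow> 'b" and sc :: "'k \<Rightarrow> 'c \<Rightarrow> 'c"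
  assumes sa: "vector_space sa" and sc: "vector_space sc"
    and Nsa: "\<And>c h. N (sa c h) = norm c * N h" and Nsc: "\<And>c z. norm (sc c z) = norm c * norm z"
    and Tadd: "\<And>g h a b. T (g + h, a + b) = T (g, a) + T (h, b)"
    and Tsc: "\<And>c h a. T (sa c h, sb c a) = sc c (T (h, a))"
    and bound: "\<And>h a. norm (T (h, a)) \<le> K * sqrt ((N h)\<^sup>2 + (norm a)\<^sup>2)"
  shows "\<exists>!F. is_extension sa sb sc N T F"
proof -
  interpret C: Metric_space "norm_completion N" "completion_dist N" by (rule Metric_space_completion)
  interpret X: Metric_space "completed_prod N :: ((nat \<Rightarrow> 'a) set \<times> 'b) set"
    "prod_dist (completion_dist N) dist" by (rule Metric_space_completed_prod)
  interpret sa: vector_space sa by (rule sa)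
  interpret sc: vector_space sc by (rule sc)
  have Tdiff: "T (g - h, a - b) = T (g, a) - T (h, b)" for g h a b
    using Tadd[of "g - h" h "a - b" b] by simp
  define L where "L = \<bar>K\<bar> + 1"
  have L: "L > 0" and KL: "K \<le> L" by (simp_all add: L_def)
  have bd: "norm (T (g, a) - T (h, b)) \<le> L * sqrt ((N (g - h))\<^sup>2 + (norm (a - b))\<^sup>2)" for g h a b
    using bound[of "g - h" "a - b"]
      mult_right_mono[OF KL, of "sqrt ((N (g - h))\<^sup>2 + (norm (a - b))\<^sup>2)"]
    unfolding Tdiff by simp
  have bd0: "norm (T (g, a) - T (h, a)) \<le> L * N (g - h)" for g h a
    using bd[of g a h a] N_nonneg by simp
  have conv: "convergent (\<lambda>n. T (x n, a))" if x: "x \<in> cauchy_seqs N" for x a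
  proof -
    have "Cauchy (\<lambda>n. T (x n, a))"
    proof (rule CauchyI)
      fix e :: real assume "e > 0"
      then have "e / L > 0" using L by simp
      then obtain k where k: "\<And>m n. k \<le> m \<Longrightarrow> k \<le> n \<Longrightarrow> N (x m - x n) < e / L"
        using x unfolding cauchy_seqs_iff by blast
      have "norm (T (x m, a) - T (x n, a)) < e" if "m \<ge> k" "n \<ge> k" for m n
        using bd0[of "x m" a "x n"] k[OF that] L by (simp add: field_simps)
      then show "\<exists>M. \<forall>m\<ge>M. \<forall>n\<ge>M. norm (T (x m, a) - T (x n, a)) < e" by blast
    qed
    then show ?thesis by (simp add: Cauchy_convergent)
  qed
  define F where "F = restrict (\<lambda>(P, a). lim (\<lambda>n. T ((SOME x. x \<in> P) n, a))) (completed_prod N)"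
  have Flim: "(\<lambda>n. T (x n, a)) \<longlonglongrightarrow> F (cls x, a)" if x: "x \<in> cauchy_seqs N" for x a
  proof -
    define y where "y = (SOME y. y \<in> cls x)"
    have y: "y \<in> cls x" unfolding y_def by (rule someI[of "\<lambda>y. y \<in> cls x", OF self_in_cls[OF x]])
    then have yc: "y \<in> cauchy_seqs N" and xy: "(\<lambda>n. N (x n - y n)) \<longlonglongrightarrow> 0" unfolding in_cls_iff by auto
    have "(\<lambda>n. L * N (x n - y n)) \<longlonglongrightarrow> 0" using tendsto_mult_left[OF xy, of L] by simp
    then have d: "(\<lambda>n. T (x n, a) - T (y n, a)) \<longlonglongrightarrow> 0"
      by (rule Lim_null_comparison[rotated]) (simp add: bd0)
    have "(\<lambda>n. T (y n, a)) \<longlonglongrightarrow> F (cls x, a)"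
      using conv[OF yc] x by (simp add: F_def completed_prod_def cls_in y_def convergent_LIMSEQ_iff)
    from tendsto_add[OF d this] show ?thesis by simp
  qed
  have Flip: "dist (F z) (F w) \<le> L * prod_dist (completion_dist N) dist z w"
    if zw: "z \<in> completed_prod N" "w \<in> completed_prod N" for z w
  proof -
    obtain x a where x: "x \<in> cauchy_seqs N" and z: "z = (cls x, a)"
      using zw(1) by (rule completion_pairE)
    obtain y b where y: "y \<in> cauchy_seqs N" and w: "w = (cls y, b)"
      using zw(2) by (rule completion_pairE)
    have "norm (F z - F w) \<le> L * sqrt ((completion_dist N (cls x) (cls y))\<^sup>2 + (norm (a - b))\<^sup>2)"
    proof (rule LIMSEQ_le)
      show "(\<lambda>n. norm (T (x n, a) - T (y n, b))) \<longlonglongrightarrow> norm (F z - F w)"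
        unfolding z w using x y by (intro tendsto_intros Flim)
      show "(\<lambda>n. L * sqrt ((N (x n - y n))\<^sup>2 + (norm (a - b))\<^sup>2)) \<longlonglongrightarrow>
          L * sqrt ((completion_dist N (cls x) (cls y))\<^sup>2 + (norm (a - b))\<^sup>2)"
        using x y by (intro tendsto_intros completion_dist_tendsto)
    qed (use bd in auto)
    then show ?thesis by (simp add: z w prod_dist_def dist_norm)
  qed
  have Fcont: "continuous_map (completed_prod_topology N) euclidean F"
    unfolding completed_prod_topology_def mtopology_is_euclidean[symmetric]
      X.metric_continuous_map[OF Met_TC.Metric_space_axioms]
  proof (intro conjI ballI allI impI)
    fix z :: "(nat \<Rightarrow> 'a) set \<times> 'b" and e :: real
    assume z: "z \<in> completed_prod N" and e: "e > 0"
    have "dist (F z) (F w) < e"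
      if w: "w \<in> completed_prod N" "prod_dist (completion_dist N) dist z w < e / L" for w
      using Flip[OF z w(1)] w(2) L by (simp add: field_simps)
    then show "\<exists>\<delta>>0. \<forall>w. w \<in> completed_prod N \<and> prod_dist (completion_dist N) dist z w < \<delta>
        \<longrightarrow> dist (F z) (F w) < e"
      using e L by (intro exI[of _ "e / L"]) auto
  qed simp
  have Fadd: "F (completion_add N P Q, a + b) = F (P, a) + F (Q, b)"
    if PQ: "P \<in> norm_completion N" "Q \<in> norm_completion N" for P Q a b
  proof -
    obtain x where x: "x \<in> cauchy_seqs N" "P = cls x" using PQ(1) by (rule completionE)
    obtain y where y: "y \<in> cauchy_seqs N" "Q = cls y" using PQ(2) by (rule completionE)
    have "(\<lambda>n. T (x n, a) + T (y n, b)) \<longlonglongrightarrow> F (cls (\<lambda>n. x n + y n), a + b)"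
      using Flim[OF cauchy_add[OF x(1) y(1)], of "a + b"] by (simp add: Tadd)
    moreover have "(\<lambda>n. T (x n, a) + T (y n, b)) \<longlonglongrightarrow> F (P, a) + F (Q, b)"
      unfolding x(2) y(2) using x(1) y(1) by (intro tendsto_add Flim)
    ultimately show ?thesis
      unfolding x(2) y(2) completion_add_cls[OF x(1) y(1)] by (rule LIMSEQ_unique)
  qed
  have cs: "(\<lambda>n. sa c (x n)) \<in> cauchy_seqs N" if x: "x \<in> cauchy_seqs N" for c x
    unfolding cauchy_seqs_iff
  proof (intro allI impI)
    fix e :: real assume "e > 0"
    have D: "norm c + 1 > 0" by (rule add_nonneg_pos) simp_all
    have "e / (norm c + 1) > 0" using \<open>e > 0\<close> D by (rule divide_pos_pos)
    then obtain k where k: "\<And>m n. k \<le> m \<Longrightarrow> k \<le> n \<Longrightarrow> N (x m - x n) < e / (norm c + 1)"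
      using x unfolding cauchy_seqs_iff by blast
    have "N (sa c (x m) - sa c (x n)) < e" if mn: "m \<ge> k" "n \<ge> k" for m n
    proof -
      have "N (sa c (x m) - sa c (x n)) = norm c * N (x m - x n)"
        by (simp add: Nsa flip: sa.scale_right_diff_distrib)
      also have "\<dots> \<le> (norm c + 1) * N (x m - x n)" using N_nonneg by (simp add: algebra_simps)
      also have "\<dots> < e" using k[OF mn] D by (simp only: pos_less_divide_eq mult.commute)
      finally show ?thesis .
    qed
    then show "\<exists>k. \<forall>m n. k \<le> m \<longrightarrow> k \<le> n \<longrightarrow> N (sa c (x m) - sa c (x n)) < e" by blast
  qed
  have scale_cls: "completion_scale sa N c (cls x) = cls (\<lambda>n. sa c (x n))"
    if x: "x \<in> cauchy_seqs N" for c x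
  proof -
    have "cls (\<lambda>n. sa c (x' n)) = cls (\<lambda>n. sa c (x n))" if x': "x' \<in> cls x" for x'
    proof -
      have c: "x' \<in> cauchy_seqs N" and l: "(\<lambda>n. N (x n - x' n)) \<longlonglongrightarrow> 0" using x' in_cls_iff by auto
      have "(\<lambda>n. N (sa c (x n) - sa c (x' n))) \<longlonglongrightarrow> 0"
        using tendsto_mult_left[OF l, of "norm c"] by (simp add: Nsa flip: sa.scale_right_diff_distrib)
      then have "cls (\<lambda>n. sa c (x n)) = cls (\<lambda>n. sa c (x' n))"
        by (subst cls_eq_iff) (simp_all add: cs x c)
      then show ?thesis by simp
    qed
    then show ?thesis unfolding completion_scale_def using self_in_cls[OF x] by blast
  qed
  have Fsc: "F (completion_scale sa N c P, sb c a) = sc c (F (P, a))" if PN: "P \<in> norm_completion N" for c P a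
  proof -
    obtain x where x: "x \<in> cauchy_seqs N" "P = cls x" using PN by (rule completionE)
    have "(\<lambda>n. norm c * norm (T (x n, a) - F (P, a))) \<longlonglongrightarrow> 0"
      using tendsto_mult_left[OF tendsto_norm_zero[OF LIM_zero[OF Flim[OF x(1), of a]]], of "norm c"]
      by (simp add: x(2))
    moreover have "norm c * norm (T (x n, a) - F (P, a)) = norm (T (sa c (x n), sb c a) - sc c (F (P, a)))" for n
      by (simp add: Tsc flip: Nsc sc.scale_right_diff_distrib)
    ultimately have "(\<lambda>n. T (sa c (x n), sb c a)) \<longlonglongrightarrow> sc c (F (P, a))"
      by (simp add: tendsto_norm_zero_iff LIM_zero_iff)
    moreover have "(\<lambda>n. T (sa c (x n), sb c a)) \<longlonglongrightarrow> F (completion_scale sa N c P, sb c a)"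
      unfolding x(2) scale_cls[OF x(1)] by (rule Flim[OF cs[OF x(1)]])
    ultimately show ?thesis using LIMSEQ_unique by blast
  qed
  have Femb: "F (completion_embed N h, a) = T (h, a)" for h a
    using LIMSEQ_unique[OF Flim[OF const_cauchy] tendsto_const] by (simp add: cls_const)
  have "is_extension sa sb sc N T F"
    using Fcont Fadd Fsc Femb by (simp add: is_extension_def F_def)
  then show ?thesis using extension_unique by blast
qed

end

end

theory Submission
  imports Defs
begin

text \<open>
  Two facts are combined. The first is Douglas' range inclusion: the estimate
  \<open>\<parallel>A\<^sub>1\<^sup>* y\<parallel> \<le> C \<parallel>B\<^sub>1\<^sup>* y\<parallel>\<close> makes \<open>B\<^sub>1\<^sup>* y \<mapsto> \<langle>A\<^sub>1\<^sup>* y, h\<^sub>1\<rangle>\<close> a well defined bounded functional on the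
  range of \<open>B\<^sub>1\<^sup>*\<close>, and a vector \<open>g\<close> representing it satisfies \<open>B\<^sub>1 g = A\<^sub>1 h\<^sub>1\<close>
  (lemma \<open>range_inclusion\<close>). The second is that \<open>B\<^sub>2\<close> maps the kernel of \<open>B\<^sub>1\<close> onto a dense
  subspace (lemma \<open>dense_image_of_kernel\<close>). So \<open>g\<close> can be corrected by some \<open>k\<close> with \<open>B\<^sub>1 k = 0\<close> such
  that \<open>B\<^sub>2 k\<close> is as close as desired to \<open>A\<^sub>2 h\<^sub>1 - B\<^sub>2 g\<close>, and \<open>h\<^sub>2 = g + k\<close> is the required vector.

  The density is where the kernel of the extension to the completed space enters. If \<open>h\<^sub>5\<close> is
  orthogonal to the image under \<open>B\<^sub>2\<close> of the kernel of \<open>B\<^sub>1\<close>, then \<open>B\<^sub>2\<^sup>* h\<^sub>5\<close> is orthogonal to that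
  kernel, so it is a limit of vectors \<open>B\<^sub>1\<^sup>* x\<^sub>n\<close>. The sequence \<open>- x\<^sub>n\<close> is Cauchy for the norm
  \<open>\<parallel>B\<^sub>1\<^sup>* x\<parallel>\<close> and thus is a point \<open>\<xi>\<close> of the completion; the extension of \<open>B\<^sup>*\<close> takes at
  \<open>(\<xi>, h\<^sub>5)\<close> the value \<open>- lim B\<^sub>1\<^sup>* x\<^sub>n + B\<^sub>2\<^sup>* h\<^sub>5 = 0\<close>. As its kernel is trivial, \<open>h\<^sub>5 = 0\<close>.

  All the Hilbert space theory involved (existence of adjoints, orthogonal projections, the
  functional in Douglas' argument) comes from one version of the Riesz representation theorem, lemma
  \<open>riesz_along_map\<close>, for functionals bounded by the norm of the image under a linear map \<open>T\<close>.
\<close>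

section \<open>Inner products over the real or complex field\<close>

lemma norm_rc_cnj: "norm (rc_cnj x) = norm x"
proof (cases "x = 0")
  case True
  then show ?thesis using rc_cnj_of_real[of 0, where 'k = 'a] by simp
next
  case False
  have "norm x * norm (rc_cnj x) = norm x * norm x"
    using arg_cong[OF mult_rc_cnj[of x], of norm]
    by (simp only: norm_mult norm_of_real abs_power2) (simp add: power2_eq_square)
  then show ?thesis using False by simp
qed

context hilbert_space
begin

lemma ip_add_right: "ip x (y + z) = ip x y + ip x z"
  by (metis ip_commute ip_add_left rc_cnj_add)

lemma ip_scale_right: "ip x (scale c y) = rc_cnj c * ip x y"
  by (metis ip_commute ip_scale_left rc_cnj_mult)

lemma ip_zero_left [simp]: "ip 0 y = 0"
  using ip_add_left[of 0 0 y] by simp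

lemma ip_zero_right [simp]: "ip x 0 = 0"
  using ip_add_right[of x 0 0] by simp

lemma ip_minus_left: "ip (- x) y = - ip x y"
  using ip_add_left[of x "- x" y] by (simp add: eq_neg_iff_add_eq_0 add.commute)

lemma ip_minus_right: "ip x (- y) = - ip x y"
  using ip_add_right[of x y "- y"] by (simp add: eq_neg_iff_add_eq_0 add.commute)

lemma ip_diff_left: "ip (x - y) z = ip x z - ip y z"
  using ip_add_left[of x "- y" z] by (simp add: ip_minus_left)

lemma ip_diff_right: "ip x (y - z) = ip x y - ip x z"
  using ip_add_right[of x y "- z"] by (simp add: ip_minus_right)

lemma ip_eq_0_commute: "ip x y = 0 \<longleftrightarrow> ip y x = 0"
  by (metis ip_commute norm_rc_cnj norm_eq_zero)

lemma ip_self_eq_0: "ip x x = 0 \<longleftrightarrow> x = 0"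
  by (simp add: ip_self)

lemma ip_right_cancel: "(\<And>x. ip x y = ip x z) \<Longrightarrow> y = z"
  using ip_self_eq_0[of "y - z"] by (simp add: ip_diff_right)

lemma norm_scale: "norm (scale c x) = norm c * norm x"
proof -
  have "(of_real ((norm (scale c x))\<^sup>2) :: 'k) = (c * rc_cnj c) * of_real ((norm x)\<^sup>2)"
    unfolding ip_self[symmetric] by (simp add: ip_scale_left ip_scale_right mult.assoc)
  then have "(of_real ((norm (scale c x))\<^sup>2) :: 'k) = of_real ((norm c * norm x)\<^sup>2)"
    unfolding mult_rc_cnj by (simp add: power_mult_distrib)
  then have "(norm (scale c x))\<^sup>2 = (norm c * norm x)\<^sup>2" by (simp only: of_real_eq_iff)
  then show ?thesis by (simp add: power2_eq_iff_nonneg)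
qed

lemma parallelogram:
  fixes x y :: 'a
  shows "(norm (x + y))\<^sup>2 + (norm (x - y))\<^sup>2 = 2 * (norm x)\<^sup>2 + 2 * (norm y)\<^sup>2"
proof -
  have "ip (x + y) (x + y) + ip (x - y) (x - y) = (ip x x + ip x x) + (ip y y + ip y y)"
    by (simp add: ip_add_left ip_add_right ip_diff_left ip_diff_right)
  then show ?thesis
    unfolding ip_self of_real_add[symmetric] of_real_eq_iff by simp
qed

text \<open>
  The subtracted vector is the orthogonal projection of \<open>x\<close> onto the line through \<open>y\<close>. The
  Cauchy-Schwarz inequality expresses that the right hand side is not negative, and the
  orthogonality of a minimiser follows by comparing with this value.
\<close>

lemma norm_minus_line_projection:
  assumes "y \<noteq> 0"
  shows "(norm (x - scale (of_real (inverse ((norm y)\<^sup>2)) * ip x y) y))\<^sup>2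
    = (norm x)\<^sup>2 - (norm (ip x y))\<^sup>2 / (norm y)\<^sup>2"
proof -
  define r where "r = (norm y)\<^sup>2"
  define c where "c = of_real (inverse r) * ip x y"
  have r: "r \<noteq> 0" using assms by (simp add: r_def)
  have cc: "rc_cnj c = of_real (inverse r) * ip y x"
    unfolding c_def rc_cnj_mult rc_cnj_of_real ip_commute[of y x] by (rule refl)
  have a: "ip x y * ip y x = of_real ((norm (ip x y))\<^sup>2)"
    by (metis ip_commute mult_rc_cnj)
  have "(of_real ((norm (x - scale c y))\<^sup>2) :: 'k)
      = ip x x - rc_cnj c * ip x y - c * ip y x + c * rc_cnj c * of_real r"
    unfolding ip_self[symmetric] r_def
    by (simp add: ip_diff_left ip_diff_right ip_scale_left ip_scale_right algebra_simps)
  also have "\<dots> = ip x x - of_real (inverse r) * (ip x y * ip y x)"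
    unfolding cc using r by (simp add: c_def field_simps)
  also have "\<dots> = of_real ((norm x)\<^sup>2 - (norm (ip x y))\<^sup>2 / r)"
    unfolding a ip_self by (simp add: field_simps)
  finally show ?thesis by (simp only: of_real_eq_iff c_def r_def)
qed

lemma norm_ip_le: "norm (ip x y) \<le> norm x * norm y"
proof (cases "y = 0")
  case False
  have "0 \<le> (norm x)\<^sup>2 - (norm (ip x y))\<^sup>2 / (norm y)\<^sup>2"
    unfolding norm_minus_line_projection[OF False, symmetric] by simp
  then have "(norm (ip x y))\<^sup>2 \<le> (norm x * norm y)\<^sup>2"
    using False by (simp add: field_simps power_mult_distrib)
  then show ?thesis by (rule power2_le_imp_le) simp
qed simp

lemma tendsto_ip_left:
  assumes "x \<longlonglongrightarrow> a"
  shows "(\<lambda>n. ip (x n) y) \<longlonglongrightarrow> ip a y"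
proof -
  have "(\<lambda>n. norm (x n - a) * norm y) \<longlonglongrightarrow> 0"
    using tendsto_mult_right[OF tendsto_norm_zero[OF LIM_zero[OF assms]], of "norm y"] by simp
  then have "(\<lambda>n. ip (x n) y - ip a y) \<longlonglongrightarrow> 0"
    by (rule Lim_null_comparison[rotated])
      (simp add: norm_ip_le flip: ip_diff_left)
  then show ?thesis by (simp add: LIM_zero_iff)
qed

section \<open>Riesz representation, projections and adjoints\<close>

lemma continuous_linear_bounded:
  assumes H: "hilbert_space s2 ip2" and T: "continuous_linear scale s2 T"
  obtains K where "K > 0" "\<And>x. norm (T x) \<le> K * norm x"
proof -
  interpret H2: hilbert_space s2 ip2 by (rule H)
  interpret T: Vector_Spaces.linear scale s2 T using T by (simp add: continuous_linear_def)
  have "isCont T 0" using T by (simp add: continuous_linear_def continuous_on_eq_continuous_at)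
  then obtain d where d: "d > 0" "\<And>x. dist x 0 < d \<Longrightarrow> dist (T x) (T 0) < 1"
    unfolding continuous_at_eps_delta by (metis zero_less_one)
  have "norm (T x) \<le> 2 / d * norm x" for x
  proof (cases "x = 0")
    case False
    define t where "t = d / (2 * norm x)"
    have t: "t > 0" using d False by (simp add: t_def)
    have "norm (t *\<^sub>R x) < d" using False d by (simp add: t_def)
    then have "norm (T (scale (of_real t) x)) < 1"
      using d(2)[of "t *\<^sub>R x"] by (simp add: scale_of_real)
    then have "t * norm (T x) < 1" using t by (simp add: T.scale H2.norm_scale)
    then show ?thesis using False d by (simp add: t_def field_simps)
  qed simp
  then show ?thesis using d by (intro that[of "2 / d"]) auto
qed

text \<open>
  As \<open>f\<close> vanishes where \<open>T\<close> does, it factors through a bounded functional on \<open>T ` S\<close>, and \<open>g\<close> is its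
  Riesz representative in the closure of \<open>T ` S\<close>. Working with \<open>T\<close> and a sequence in \<open>S\<close> avoids forming
  the closure and extending the functional to it. The proof is the classical one: a minimising
  sequence for \<open>\<parallel>T v\<parallel>\<close> on the hyperplane \<open>f v = 1\<close> has Cauchy images by the parallelogram law,
  their limit \<open>u\<close> is orthogonal to the images of the kernel of \<open>f\<close>, and \<open>g\<close> is the multiple
  \<open>u / \<parallel>u\<parallel>\<^sup>2\<close>. With \<open>T\<close> the identity this is the usual theorem; with \<open>T\<close> the inclusion of a
  subspace and \<open>f\<close> the inner product with a vector it yields the projection of that vector.
\<close>

lemma riesz_along_map:
  fixes T :: "'v::ab_group_add \<Rightarrow> 'a"
  assumes T: "Vector_Spaces.linear sv scale T" and f: "Vector_Spaces.linear sv (*) f"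
    and S: "module.subspace sv S"
    and bd: "\<And>v. v \<in> S \<Longrightarrow> norm (f v) \<le> C * norm (T v)"
  obtains g v where "\<And>n. v n \<in> S" "(\<lambda>n. T (v n)) \<longlonglongrightarrow> g" "\<And>w. w \<in> S \<Longrightarrow> f w = ip (T w) g"
proof (cases "\<forall>w\<in>S. f w = 0")
  case True
  interpret T: Vector_Spaces.linear sv scale T by (rule T)
  show ?thesis
    using True T.vs1.subspace_0[OF S] by (intro that[of "\<lambda>_. 0" 0]) auto
next
  case False
  interpret T: Vector_Spaces.linear sv scale T by (rule T)
  interpret f: Vector_Spaces.linear sv "(*)" f by (rule f)
  define A where "A = {v \<in> S. f v = 1}"
  define d where "d = Inf ((\<lambda>v. norm (T v)) ` A)"
  obtain w0 where w0: "w0 \<in> S" "f w0 \<noteq> 0" using False by blast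
  have "sv (inverse (f w0)) w0 \<in> A"
    using w0 T.vs1.subspace_scale[OF S] by (simp add: A_def f.scale)
  then have ne: "(\<lambda>v. norm (T v)) ` A \<noteq> {}" by blast
  have bb: "bdd_below ((\<lambda>v. norm (T v)) ` A)" by (rule bdd_belowI[of _ 0]) auto
  have dle: "d \<le> norm (T v)" if "v \<in> A" for v
    unfolding d_def by (rule cInf_lower[OF imageI[OF that] bb])
  have d0: "d \<ge> 0" unfolding d_def using ne by (rule cInf_greatest) auto
  have "\<exists>v\<in>A. norm (T v) < d + inverse (real (Suc n))" for n
    using cInf_lessD[OF ne, of "d + inverse (real (Suc n))"] by (auto simp: d_def)
  then obtain v where vA: "\<And>n. v n \<in> A" and vd: "\<And>n. norm (T (v n)) < d + inverse (real (Suc n))"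
    by metis
  have lim: "(\<lambda>n. norm (T (v n))) \<longlonglongrightarrow> d"
  proof (rule tendsto_sandwich[of "\<lambda>_. d"])
    show "(\<lambda>n. d + inverse (real (Suc n))) \<longlonglongrightarrow> d"
      using tendsto_add[OF tendsto_const[of d] LIMSEQ_inverse_real_of_nat] by simp
    show "\<forall>\<^sub>F n in sequentially. norm (T (v n)) \<le> d + inverse (real (Suc n))"
      by (intro always_eventually allI less_imp_le[OF vd])
  qed (simp_all add: dle vA)
  \<comment> \<open>The midpoint of two points of the hyperplane lies on it, so its image has norm at least
    \<open>d\<close>.\<close>
  have mid: "(norm (T (v m) - T (v n)))\<^sup>2 \<le> 2 * ((norm (T (v m)))\<^sup>2 - d\<^sup>2) + 2 * ((norm (T (v n)))\<^sup>2 - d\<^sup>2)" for m n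
  proof -
    have "sv (inverse 2) (v m + v n) \<in> A"
      using vA[of m] vA[of n] T.vs1.subspace_scale[OF S] T.vs1.subspace_add[OF S]
      by (simp add: A_def f.scale f.add)
    from dle[OF this] have "d \<le> norm (T (v m) + T (v n)) / 2"
      by (simp add: T.scale T.add norm_scale norm_inverse)
    then have "2 * d \<le> norm (T (v m) + T (v n))" by simp
    then have "(2 * d)\<^sup>2 \<le> (norm (T (v m) + T (v n)))\<^sup>2" by (rule power_mono) (use d0 in simp)
    then show ?thesis using parallelogram[of "T (v m)" "T (v n)"] by (simp add: power_mult_distrib)
  qed
  have "Cauchy (\<lambda>n. T (v n))"
  proof (rule CauchyI)
    fix e :: real assume e: "e > 0"
    have "(\<lambda>n. (norm (T (v n)))\<^sup>2 - d\<^sup>2) \<longlonglongrightarrow> 0"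
      using LIM_zero[OF tendsto_power[OF lim, of 2]] .
    moreover have "e\<^sup>2 / 4 > 0" using e by simp
    ultimately have "\<forall>\<^sub>F n in sequentially. (norm (T (v n)))\<^sup>2 - d\<^sup>2 < e\<^sup>2 / 4" by (rule order_tendstoD)
    then obtain M where M: "\<And>n. n \<ge> M \<Longrightarrow> (norm (T (v n)))\<^sup>2 - d\<^sup>2 < e\<^sup>2 / 4"
      unfolding eventually_sequentially by blast
    have "norm (T (v m) - T (v n)) < e" if "m \<ge> M" "n \<ge> M" for m n
    proof (rule power2_less_imp_less)
      show "(norm (T (v m) - T (v n)))\<^sup>2 < e\<^sup>2" using mid[of m n] M[OF that(1)] M[OF that(2)] by argo
    qed (use e in simp)
    then show "\<exists>M. \<forall>m\<ge>M. \<forall>n\<ge>M. norm (T (v m) - T (v n)) < e" by blast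
  qed
  then obtain u where u: "(\<lambda>n. T (v n)) \<longlonglongrightarrow> u" using Cauchy_convergent convergent_def by blast
  have nu: "norm u = d" using LIMSEQ_unique[OF tendsto_norm[OF u] lim] .
  have "1 \<le> C * norm (T (v n))" for n using bd[of "v n"] vA[of n] by (simp add: A_def)
  then have "1 \<le> C * norm u"
    using LIMSEQ_le_const[OF tendsto_mult_left[OF tendsto_norm[OF u], of C]] by blast
  then have u0: "u \<noteq> 0" by auto
  \<comment> \<open>Moving along \<open>w\<close> with \<open>f w = 0\<close> does not leave the hyperplane, so it cannot bring
    \<open>u\<close> closer to the origin.\<close>
  have orth: "ip (T w) u = 0" if w: "w \<in> S" "f w = 0" for w
  proof (cases "T w = 0")
    case False
    define c where "c = of_real (inverse ((norm (T w))\<^sup>2)) * ip u (T w)"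
    have "d \<le> norm (T (v n) - scale c (T w))" for n
      using dle[of "v n - sv c w"] vA[of n] w T.vs1.subspace_scale[OF S] T.vs1.subspace_diff[OF S]
      by (simp add: A_def f.scale f.diff T.diff T.scale)
    moreover have "(\<lambda>n. norm (T (v n) - scale c (T w))) \<longlonglongrightarrow> norm (u - scale c (T w))"
      by (intro tendsto_intros u)
    ultimately have "d \<le> norm (u - scale c (T w))" using LIMSEQ_le_const by blast
    then have "d\<^sup>2 \<le> (norm (u - scale c (T w)))\<^sup>2" by (rule power_mono) (rule d0)
    then have "(norm (ip u (T w)))\<^sup>2 / (norm (T w))\<^sup>2 \<le> 0"
      unfolding c_def norm_minus_line_projection[OF False] nu by simp
    then have "ip u (T w) = 0" using False by (simp add: divide_le_0_iff)
    then show ?thesis by (simp add: ip_eq_0_commute)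
  qed simp
  \<comment> \<open>Subtracting \<open>f w\<close> times a point of the hyperplane moves \<open>w\<close> into the kernel of \<open>f\<close>.\<close>
  have val: "ip (T w) u = f w * of_real ((norm u)\<^sup>2)" if w: "w \<in> S" for w
  proof -
    have "ip (T w) u = f w * ip (T (v n)) u" for n
    proof -
      have "ip (T (w - sv (f w) (v n))) u = 0"
        using vA[of n] w T.vs1.subspace_scale[OF S] T.vs1.subspace_diff[OF S]
        by (intro orth) (simp_all add: A_def f.scale f.diff)
      then show ?thesis by (simp add: T.diff T.scale ip_diff_left ip_scale_left)
    qed
    then have "(\<lambda>n. f w * ip (T (v n)) u) \<longlonglongrightarrow> ip (T w) u" by simp
    moreover have "(\<lambda>n. f w * ip (T (v n)) u) \<longlonglongrightarrow> f w * ip u u"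
      by (intro tendsto_mult_left tendsto_ip_left u)
    ultimately show ?thesis unfolding ip_self[symmetric] using LIMSEQ_unique by blast
  qed
  define r where "r = inverse ((norm u)\<^sup>2)"
  show ?thesis
  proof (rule that)
    show "sv (of_real r) (v n) \<in> S" for n
      using vA[of n] T.vs1.subspace_scale[OF S] by (simp add: A_def)
    show "(\<lambda>n. T (sv (of_real r) (v n))) \<longlonglongrightarrow> r *\<^sub>R u"
      unfolding T.scale scale_of_real by (intro tendsto_scaleR tendsto_const u)
    show "f w = ip (T w) (r *\<^sub>R u)" if "w \<in> S" for w
      using u0 unfolding scale_of_real[symmetric] ip_scale_right rc_cnj_of_real val[OF that]
      by (simp add: r_def)
  qed
qed

lemma linear_ip_left: "Vector_Spaces.linear scale (*) (\<lambda>x. ip x y)"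
  by (simp add: Vector_Spaces.linear_iff ip_add_left ip_scale_left vector_space_axioms)
    (unfold_locales, simp_all add: algebra_simps)

text \<open>
  The projection \<open>p\<close> of \<open>x\<close> onto the closure of \<open>T ` S\<close> represents the functional \<open>\<langle>T v, x\<rangle>\<close>.
\<close>

lemma projection_onto_closure:
  fixes T :: "'v::ab_group_add \<Rightarrow> 'a"
  assumes T: "Vector_Spaces.linear sv scale T" and S: "module.subspace sv S"
  obtains p v where "\<And>n. v n \<in> S" "(\<lambda>n. T (v n)) \<longlonglongrightarrow> p" "\<And>w. w \<in> S \<Longrightarrow> ip (T w) (x - p) = 0"
proof -
  have lin: "Vector_Spaces.linear sv (*) (\<lambda>v. ip (T v) x)"
    using Vector_Spaces.linear_compose[OF T linear_ip_left[of x]] by (simp add: o_def)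
  have bd: "norm (ip (T v) x) \<le> norm x * norm (T v)" for v
    using norm_ip_le[of "T v" x] by (simp add: mult.commute)
  show ?thesis
  proof (rule riesz_along_map[OF T lin S bd])
    fix p v
    assume "\<And>n. v n \<in> S" "(\<lambda>n. T (v n)) \<longlonglongrightarrow> p" "\<And>w. w \<in> S \<Longrightarrow> ip (T w) x = ip (T w) p"
    then show ?thesis by (intro that) (simp_all add: ip_diff_right)
  qed
qed

text \<open>
  Stated for an arbitrary function \<open>ip'\<close> so that it can be applied to \<open>prod_ip\<close>: it then determines
  the adjoint of a pair without making the product type a Hilbert space.
\<close>

lemma hilbert_adjoint_eqI:
  assumes "\<And>x y. ip' (T x) y = ip x (S y)"
  shows "hilbert_adjoint ip ip' T = S"
  unfolding hilbert_adjoint_def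
proof (rule the_equality)
  fix S' assume S': "\<forall>x y. ip' (T x) y = ip x (S' y)"
  show "S' = S"
    by (rule ext, rule ip_right_cancel) (use S' assms in metis)
qed (use assms in blast)

lemma hilbert_adjoint_right:
  assumes H: "hilbert_space s2 ip2" and T: "continuous_linear scale s2 T"
  shows "ip2 (T x) y = ip x (hilbert_adjoint ip ip2 T y)"
proof -
  interpret H2: hilbert_space s2 ip2 by (rule H)
  have lT: "Vector_Spaces.linear scale s2 T" using T by (simp add: continuous_linear_def)
  obtain K where K: "K > 0" "\<And>x. norm (T x) \<le> K * norm x"
    using continuous_linear_bounded[OF H T] by blast
  have "\<exists>g. \<forall>x. ip2 (T x) y = ip x g" for y
  proof -
    have bd: "norm (ip2 (T x) y) \<le> (K * norm y) * norm (id x)" for x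
      using H2.norm_ip_le[of "T x" y] mult_right_mono[OF K(2)[of x], of "norm y"] by (simp add: mult_ac)
    have "Vector_Spaces.linear scale (*) (\<lambda>x. ip2 (T x) y)"
      using Vector_Spaces.linear_compose[OF lT H2.linear_ip_left[of y]] by (simp add: o_def)
    then show ?thesis
      by (rule riesz_along_map[OF linear_id _ subspace_UNIV bd]) auto
  qed
  then obtain S where S: "\<And>x y. ip2 (T x) y = ip x (S y)" by metis
  then have "hilbert_adjoint ip ip2 T = S" by (rule hilbert_adjoint_eqI)
  then show ?thesis using S by simp
qed

lemma linear_hilbert_adjoint:
  assumes H: "hilbert_space s2 ip2" and T: "continuous_linear scale s2 T"
  shows "Vector_Spaces.linear s2 scale (hilbert_adjoint ip ip2 T)"
proof -
  interpret H2: hilbert_space s2 ip2 by (rule H)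
  note adj = hilbert_adjoint_right[OF H T]
  show ?thesis
    unfolding Vector_Spaces.linear_iff
  proof (intro conjI allI)
    show "hilbert_adjoint ip ip2 T (x + y) = hilbert_adjoint ip ip2 T x + hilbert_adjoint ip ip2 T y" for x y
      by (rule ip_right_cancel) (simp add: ip_add_right H2.ip_add_right flip: adj)
    show "hilbert_adjoint ip ip2 T (s2 c x) = scale c (hilbert_adjoint ip ip2 T x)" for c x
      by (rule ip_right_cancel) (simp add: ip_scale_right H2.ip_scale_right flip: adj)
  qed (rule H2.vector_space_axioms vector_space_axioms)+
qed

lemma norm_hilbert_adjoint_le:
  assumes H: "hilbert_space s2 ip2" and T: "continuous_linear scale s2 T"
  obtains K where "K > 0" "\<And>y. norm (hilbert_adjoint ip ip2 T y) \<le> K * norm y"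
proof -
  interpret H2: hilbert_space s2 ip2 by (rule H)
  obtain K where K: "K > 0" "\<And>x. norm (T x) \<le> K * norm x"
    using continuous_linear_bounded[OF H T] by blast
  have "norm (hilbert_adjoint ip ip2 T y) \<le> K * norm y" for y
  proof (cases "hilbert_adjoint ip ip2 T y = 0")
    case False
    define z where "z = hilbert_adjoint ip ip2 T y"
    have "(norm z)\<^sup>2 = norm (ip z z)"
      unfolding ip_self norm_of_real by simp
    also have "\<dots> = norm (ip2 (T z) y)"
      unfolding hilbert_adjoint_right[OF H T] z_def ..
    also have "\<dots> \<le> norm (T z) * norm y" by (rule H2.norm_ip_le)
    also have "\<dots> \<le> (K * norm z) * norm y" by (intro mult_right_mono K) simp
    finally have "norm z * norm z \<le> norm z * (K * norm y)" by (simp add: power2_eq_square mult_ac)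
    then show ?thesis using False by (simp add: z_def)
  qed (use K in simp)
  then show ?thesis using K that by blast
qed

lemma pair_adjoint_eq:
  assumes "hilbert_space s4 ip4" "hilbert_space s5 ip5"
    and "continuous_linear scale s4 B1" "continuous_linear scale s5 B2"
  shows "pair_adjoint ip ip4 ip5 B1 B2
    = (\<lambda>(a, b). hilbert_adjoint ip ip4 B1 a + hilbert_adjoint ip ip5 B2 b)"
  unfolding pair_adjoint_def
  by (rule hilbert_adjoint_eqI)
    (simp add: prod_ip_def case_prod_beta ip_add_right hilbert_adjoint_right[OF assms(1,3)] hilbert_adjoint_right[OF assms(2,4)])

lemma hilbert_adjoint_left:
  assumes H: "hilbert_space s2 ip2" and T: "continuous_linear scale s2 T"
  shows "ip (hilbert_adjoint ip ip2 T y) x = ip2 y (T x)"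
  using hilbert_adjoint_right[OF H T, of x y] ip_commute hilbert_space.ip_commute[OF H] by metis

section \<open>Range inclusion\<close>

text \<open>
  The vector \<open>g\<close> represents the functional \<open>v \<mapsto> \<langle>A\<^sup>* v, h\<rangle>\<close> along \<open>B\<^sup>*\<close>: from
  \<open>\<langle>A\<^sup>* v, h\<rangle> = \<langle>B\<^sup>* v, g\<rangle>\<close>, that is \<open>\<langle>v, A h\<rangle> = \<langle>v, B g\<rangle>\<close>, for all \<open>v\<close> one gets \<open>B g = A h\<close>.
\<close>

lemma range_inclusion:
  assumes H1: "hilbert_space s1 ip1" and H4: "hilbert_space s4 ip4"
    and A: "continuous_linear s1 s4 A" and B: "continuous_linear scale s4 B"
    and bd: "\<And>y. norm (hilbert_adjoint ip1 ip4 A y) \<le> C * norm (hilbert_adjoint ip ip4 B y)"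
  shows "\<exists>g. B g = A h"
proof -
  interpret H1: hilbert_space s1 ip1 by (rule H1)
  interpret H4: hilbert_space s4 ip4 by (rule H4)
  have lin: "Vector_Spaces.linear s4 (*) (\<lambda>v. ip1 (hilbert_adjoint ip1 ip4 A v) h)"
    using Vector_Spaces.linear_compose[OF H1.linear_hilbert_adjoint[OF H4 A] H1.linear_ip_left[of h]]
    by (simp add: o_def)
  have le: "norm (ip1 (hilbert_adjoint ip1 ip4 A v) h) \<le> (C * norm h) * norm (hilbert_adjoint ip ip4 B v)" for v
    using H1.norm_ip_le[of "hilbert_adjoint ip1 ip4 A v" h] mult_right_mono[OF bd[of v], of "norm h"]
    by (simp add: mult_ac)
  show ?thesis
  proof (rule riesz_along_map[OF linear_hilbert_adjoint[OF H4 B] lin H4.subspace_UNIV le])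
    fix g assume g: "\<And>w. w \<in> UNIV \<Longrightarrow> ip1 (hilbert_adjoint ip1 ip4 A w) h = ip (hilbert_adjoint ip ip4 B w) g"
    have "B g = A h"
      by (rule H4.ip_right_cancel)
        (use g in \<open>simp add: hilbert_adjoint_left[OF H4 B] H1.hilbert_adjoint_left[OF H4 A]\<close>)
    then show ?thesis by blast
  qed
qed

section \<open>The extension of the adjoint to the completed space\<close>

lemma group_norm_norm_star:
  assumes H4: "hilbert_space s4 ip4" and B: "continuous_linear scale s4 B"
    and inj: "\<And>y. hilbert_adjoint ip ip4 B y = 0 \<Longrightarrow> y = 0"
  shows "group_norm (norm_star ip ip4 B)"
proof -
  interpret L: Vector_Spaces.linear s4 scale "hilbert_adjoint ip ip4 B"
    by (rule linear_hilbert_adjoint[OF H4 B])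
  show ?thesis
    by unfold_locales (auto simp: norm_star_def L.neg L.add norm_triangle_ineq inj)
qed

text \<open>
  This reduces the extension, defined by a description on classes of Cauchy sequences, to a
  concrete limit. The adjoint of the pair is bounded for the norm
  \<open>(\<parallel>B\<^sub>1\<^sup>* h\<parallel>\<^sup>2 + \<parallel>a\<parallel>\<^sup>2)\<^sup>1\<^sup>/\<^sup>2\<close>, since its first part has norm \<open>\<parallel>B\<^sub>1\<^sup>* h\<parallel>\<close> and \<open>B\<^sub>2\<^sup>*\<close> is
  bounded; hence the extension exists, and by continuity its value at the class of \<open>x\<close> is the limit
  of the values at the images of the terms \<open>x n\<close> in the completion.
\<close>

lemma completed_extension_tendsto:
  fixes s4 :: "'k \<Rightarrow> 'c::banach \<Rightarrow> 'c" and s5 :: "'k \<Rightarrow> 'd::banach \<Rightarrow> 'd"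
  assumes H4: "hilbert_space s4 ip4" and H5: "hilbert_space s5 ip5"
    and B1: "continuous_linear scale s4 B1" and B2: "continuous_linear scale s5 B2"
    and inj: "\<And>y. hilbert_adjoint ip ip4 B1 y = 0 \<Longrightarrow> y = 0"
    and x: "x \<in> cauchy_seqs (norm_star ip ip4 B1)"
  shows "(\<lambda>n. hilbert_adjoint ip ip4 B1 (x n) + hilbert_adjoint ip ip5 B2 a) \<longlonglongrightarrow>
    completed_extension s4 s5 scale (norm_star ip ip4 B1) (pair_adjoint ip ip4 ip5 B1 B2)
      (completion_rel (norm_star ip ip4 B1) `` {x}, a)"
proof -
  define N where "N = norm_star ip ip4 B1"
  define S where "S = pair_adjoint ip ip4 ip5 B1 B2"
  interpret H4: hilbert_space s4 ip4 by (rule H4)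
  interpret L1: Vector_Spaces.linear s4 scale "hilbert_adjoint ip ip4 B1"
    by (rule linear_hilbert_adjoint[OF H4 B1])
  interpret L2: Vector_Spaces.linear s5 scale "hilbert_adjoint ip ip5 B2"
    by (rule linear_hilbert_adjoint[OF H5 B2])
  interpret N: group_norm N unfolding N_def by (rule group_norm_norm_star[OF H4 B1 inj])
  have Seq: "S (h, b) = hilbert_adjoint ip ip4 B1 h + hilbert_adjoint ip ip5 B2 b" for h b
    by (simp add: S_def pair_adjoint_eq[OF H4 H5 B1 B2])
  obtain K where K: "K > 0" "\<And>y. norm (hilbert_adjoint ip ip5 B2 y) \<le> K * norm y"
    using norm_hilbert_adjoint_le[OF H5 B2] by blast
  have bound: "norm (S (h, b)) \<le> (1 + K) * sqrt ((N h)\<^sup>2 + (norm b)\<^sup>2)" for h b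
  proof -
    have "norm (S (h, b)) \<le> N h + K * norm b"
      unfolding Seq N_def norm_star_def using norm_triangle_mono[OF order_refl K(2)] .
    also have "\<dots> \<le> sqrt ((N h)\<^sup>2 + (norm b)\<^sup>2) + K * sqrt ((N h)\<^sup>2 + (norm b)\<^sup>2)"
      using K(1) by (intro add_mono mult_left_mono) (simp_all add: real_sqrt_sum_squares_ge1 real_sqrt_sum_squares_ge2)
    finally show ?thesis by (simp add: algebra_simps)
  qed
  have "\<exists>!F. is_extension s4 s5 scale N S F"
  proof (rule N.is_extension_ex1[OF H4.vector_space_axioms vector_space_axioms])
    show "N (s4 c h) = norm c * N h" for c h
      by (simp add: N_def norm_star_def L1.scale norm_scale)
  qed (use bound in \<open>simp_all add: Seq norm_scale L1.add L2.add L1.scale L2.scale scale_right_distrib\<close>)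
  then have F: "is_extension s4 s5 scale N S (completed_extension s4 s5 scale N S)"
    unfolding completed_extension_def by (rule theI')
  have "x \<in> cauchy_seqs N" using x by (simp add: N_def)
  from continuous_map_limit[OF _ N.limitin_embed_seq[OF this, of a], of euclidean "completed_extension s4 s5 scale N S"] F
  show ?thesis by (simp add: is_extension_def o_def Seq flip: N_def S_def)
qed

section \<open>Density of the image of the kernel\<close>

text \<open>
  With \<open>q\<close> the projection of \<open>w\<close> onto the closure of the image of the kernel, the vector \<open>w - q\<close> is
  orthogonal to that image, and the extended adjoint kills a point of the completed space with second
  component \<open>w - q\<close>. Triviality of its kernel then forces \<open>w = q\<close>.
\<close>

lemma dense_image_of_kernel:
  fixes s4 :: "'k \<Rightarrow> 'c::banach \<Rightarrow> 'c" and s5 :: "'k \<Rightarrow> 'd::banach \<Rightarrow> 'd"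
  assumes H4: "hilbert_space s4 ip4" and H5: "hilbert_space s5 ip5"
    and B1: "continuous_linear scale s4 B1" and B2: "continuous_linear scale s5 B2"
    and inj: "\<And>y. hilbert_adjoint ip ip4 B1 y = 0 \<Longrightarrow> y = 0"
    and ker: "\<And>z. z \<in> completed_prod (norm_star ip ip4 B1) \<Longrightarrow>
      completed_extension s4 s5 scale (norm_star ip ip4 B1) (pair_adjoint ip ip4 ip5 B1 B2) z = 0 \<Longrightarrow>
      z = completed_prod_zero (norm_star ip ip4 B1)"
    and e: "e > 0"
  shows "\<exists>k. B1 k = 0 \<and> norm (w - B2 k) \<le> e"
proof -
  define N where "N = norm_star ip ip4 B1"
  interpret H4: hilbert_space s4 ip4 by (rule H4)
  interpret H5: hilbert_space s5 ip5 by (rule H5)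
  interpret N: group_norm N unfolding N_def by (rule group_norm_norm_star[OF H4 B1 inj])
  interpret B1: Vector_Spaces.linear scale s4 B1 using B1 by (simp add: continuous_linear_def)
  have lB2: "Vector_Spaces.linear scale s5 B2" using B2 by (simp add: continuous_linear_def)
  interpret L1: Vector_Spaces.linear s4 scale "hilbert_adjoint ip ip4 B1"
    by (rule linear_hilbert_adjoint[OF H4 B1])
  obtain q k where kS: "\<And>n. k n \<in> {v. B1 v = 0}" and q: "(\<lambda>n. B2 (k n)) \<longlonglongrightarrow> q"
    and orthS: "\<And>v. v \<in> {v. B1 v = 0} \<Longrightarrow> ip5 (B2 v) (w - q) = 0"
    by (rule H5.projection_onto_closure[OF lB2 B1.subspace_kernel, where x = w]) (rule that; assumption)
  have k: "B1 (k n) = 0" for n using kS by simp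
  have orth: "ip5 (B2 v) (w - q) = 0" if "B1 v = 0" for v using orthS that by simp
  define y where "y = hilbert_adjoint ip ip5 B2 (w - q)"
  have y_orth: "ip v y = 0" if "B1 v = 0" for v
    using orth[OF that] by (simp add: y_def hilbert_adjoint_right[OF H5 B2])
  \<comment> \<open>The projection \<open>p\<close> of \<open>y\<close> onto the closure of the range of \<open>B\<^sub>1\<^sup>*\<close> is \<open>y\<close> itself: the
    difference \<open>y - p\<close> lies in the kernel of \<open>B\<^sub>1\<close>, so it is orthogonal to \<open>y\<close>, and also to \<open>p\<close>.\<close>
  obtain p x where p: "(\<lambda>n. hilbert_adjoint ip ip4 B1 (x n)) \<longlonglongrightarrow> p"
    and p_orthU: "\<And>v. v \<in> UNIV \<Longrightarrow> ip (hilbert_adjoint ip ip4 B1 v) (y - p) = 0"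
    by (rule projection_onto_closure[OF L1.linear_axioms H4.subspace_UNIV, where x = y]) (rule that; assumption)
  have p_orth: "ip (hilbert_adjoint ip ip4 B1 v) (y - p) = 0" for v using p_orthU by simp
  have "B1 (y - p) = 0"
    by (rule H4.ip_right_cancel) (use p_orth in \<open>simp add: hilbert_adjoint_left[OF H4 B1]\<close>)
  then have 1: "ip y (y - p) = 0" by (subst ip_eq_0_commute) (rule y_orth)
  have "(\<lambda>n. 0) \<longlonglongrightarrow> ip p (y - p)" using tendsto_ip_left[OF p, of "y - p"] by (simp add: p_orth)
  then have "ip p (y - p) = 0" by (simp add: LIMSEQ_const_iff)
  with 1 have "ip (y - p) (y - p) = 0" by (simp add: ip_diff_left)
  then have yp: "p = y" by (simp add: ip_self_eq_0)
  have m: "(\<lambda>n. hilbert_adjoint ip ip4 B1 (- x n)) \<longlonglongrightarrow> - y"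
    using tendsto_minus[OF p] by (simp add: L1.neg yp)
  have xc: "(\<lambda>n. - x n) \<in> cauchy_seqs N"
    unfolding N.cauchy_seqs_iff
  proof (intro allI impI)
    fix e :: real assume "e > 0"
    then obtain M where "\<And>m n. M \<le> m \<Longrightarrow> M \<le> n \<Longrightarrow>
        norm (hilbert_adjoint ip ip4 B1 (- x m) - hilbert_adjoint ip ip4 B1 (- x n)) < e"
      using CauchyD[OF LIMSEQ_imp_Cauchy[OF m]] by meson
    then show "\<exists>k. \<forall>m n. k \<le> m \<longrightarrow> k \<le> n \<longrightarrow> N (- x m - - x n) < e"
      unfolding N_def norm_star_def L1.diff by (intro exI[of _ M]) simp
  qed
  have "(\<lambda>n. hilbert_adjoint ip ip4 B1 (- x n) + y) \<longlonglongrightarrow> 0"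
    using tendsto_add[OF m tendsto_const[of y]] by simp
  then have "completed_extension s4 s5 scale N (pair_adjoint ip ip4 ip5 B1 B2) (N.cls (\<lambda>n. - x n), w - q) = 0"
    using LIMSEQ_unique[OF completed_extension_tendsto[OF H4 H5 B1 B2 inj xc[unfolded N_def], of "w - q"]]
    by (simp add: N_def y_def)
  then have "(N.cls (\<lambda>n. - x n), w - q) = completed_prod_zero N"
    using ker N.cls_in[OF xc] unfolding N_def by (simp add: completed_prod_def)
  then have "w = q" by (simp add: completed_prod_zero_def)
  then have "\<forall>\<^sub>F n in sequentially. dist (B2 (k n)) w < e" using q e by (simp add: tendsto_iff)
  then obtain n where "dist (B2 (k n)) w < e" by (auto simp: eventually_sequentially)
  then show ?thesis using k by (intro exI[of _ "k n"]) (simp add: dist_norm norm_minus_commute)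
qed

end

section \<open>Exact solution of one equation and approximate solution of the other\<close>

theorem proposition2p6:
  fixes s1 :: "'k::rc_field \<Rightarrow> 'h1::banach \<Rightarrow> 'h1" and ip1 :: "'h1 \<Rightarrow> 'h1 \<Rightarrow> 'k"
    and s2 :: "'k \<Rightarrow> 'h2::banach \<Rightarrow> 'h2" and ip2 :: "'h2 \<Rightarrow> 'h2 \<Rightarrow> 'k"
    and s4 :: "'k \<Rightarrow> 'h4::banach \<Rightarrow> 'h4" and ip4 :: "'h4 \<Rightarrow> 'h4 \<Rightarrow> 'k"
    and s5 :: "'k \<Rightarrow> 'h5::banach \<Rightarrow> 'h5" and ip5 :: "'h5 \<Rightarrow> 'h5 \<Rightarrow> 'k"
    and A1 :: "'h1 \<Rightarrow> 'h4" and A2 :: "'h1 \<Rightarrow> 'h5"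
    and B1 :: "'h2 \<Rightarrow> 'h4" and B2 :: "'h2 \<Rightarrow> 'h5"
  assumes "hilbert_space s1 ip1" and "hilbert_space s2 ip2"
    and "hilbert_space s4 ip4" and "hilbert_space s5 ip5"
    and "continuous_linear s1 s4 A1" and "continuous_linear s1 s5 A2"
    and "continuous_linear s2 s4 B1" and "continuous_linear s2 s5 B2"
    and "{z. pair_adjoint ip2 ip4 ip5 B1 B2 z = 0} = {0}"
    and "{z \<in> completed_prod (norm_star ip2 ip4 B1).
            completed_extension s4 s5 s2 (norm_star ip2 ip4 B1) (pair_adjoint ip2 ip4 ip5 B1 B2) z = 0}
          = {completed_prod_zero (norm_star ip2 ip4 B1)}"
    and "\<exists>C>0. \<forall>h4. norm (hilbert_adjoint ip1 ip4 A1 h4) \<le> C * norm (hilbert_adjoint ip2 ip4 B1 h4)"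
  shows "\<forall>h1. \<forall>\<epsilon>>0. \<exists>h2. A1 h1 = B1 h2 \<and> norm (A2 h1 - B2 h2) \<le> \<epsilon>"
  proof (intro allI impI)
  fix h1 :: 'h1 and \<epsilon> :: real assume \<epsilon>: "\<epsilon> > 0"
  note H1 = assms(1) and H2 = assms(2) and H4 = assms(3) and H5 = assms(4)
  note B1 = assms(7) and B2 = assms(8)
  interpret H2: hilbert_space s2 ip2 by (rule H2)
  interpret B1: Vector_Spaces.linear s2 s4 B1 using B1 by (simp add: continuous_linear_def)
  interpret B2: Vector_Spaces.linear s2 s5 B2 using B2 by (simp add: continuous_linear_def)
  interpret L2: Vector_Spaces.linear s5 s2 "hilbert_adjoint ip2 ip5 B2"
    by (rule H2.linear_hilbert_adjoint[OF H5 B2])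
  have inj: "y = 0" if "hilbert_adjoint ip2 ip4 B1 y = 0" for y
  proof -
    have "pair_adjoint ip2 ip4 ip5 B1 B2 (y, 0) = 0"
      using that by (simp add: H2.pair_adjoint_eq[OF H4 H5 B1 B2])
    then show ?thesis using assms(9) by (auto simp: zero_prod_def)
  qed
  obtain g where g: "B1 g = A1 h1"
    using H2.range_inclusion[OF H1 H4 assms(5) B1] assms(11) by blast
  have "\<exists>k. B1 k = 0 \<and> norm (A2 h1 - B2 g - B2 k) \<le> \<epsilon>"
    by (rule H2.dense_image_of_kernel[OF H4 H5 B1 B2 inj _ \<epsilon>]) (use assms(10) in blast)+
  then obtain k where k: "B1 k = 0" "norm (A2 h1 - B2 g - B2 k) \<le> \<epsilon>" by blast
  have "A1 h1 = B1 (g + k)" using g k(1) by (simp add: B1.add)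
  moreover have "norm (A2 h1 - B2 (g + k)) \<le> \<epsilon>" using k(2) by (simp add: B2.add diff_diff_eq)
  ultimately show "\<exists>h2. A1 h1 = B1 h2 \<and> norm (A2 h1 - B2 h2) \<le> \<epsilon>" by blast
qed

end
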